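(* Let $X$ be a complex Banach space, $n\ge 1$, $a_1,\ldots,a_n\in\mathbb{C}$, and let $D:\mathcal{C}^n(\mathbb{R},X)\to\mathcal{C}(\mathbb{R},X)$ be $D(y)=y^{(n)}+a_1y^{(n-1)}+\cdots+a_ny$. Suppose the characteristic polynomial $P(z)=z^n+a_1z^{n-1}+\cdots+a_n$ has $n$ distinct roots $r_1,\ldots,r_n$, all with $\operatorname{Re} r_k\neq 0$. Let $V=V(r_1,\ldots,r_n)$ and $V_k=V(r_1,\ldots,r_{k-1},r_{k+1},\ldots,r_n)$ for $1\le k\le n$. Then the best Ulam constant $K_D$ of $D$ exists and is given by: (i) if $\operatorname{Re} r_k>0$ for all $1\le k\le n$: $K_D=\frac{1}{|V|}\int_0^\infty\Big|\sum_{k=1}^n(-1)^kV_ke^{-r_kx}\Big|\,dx$; (ii) if $\operatorname{Re} r_k<0$ for all $1\le k\le n$: $K_D=\frac{1}{|V|}\int_0^\infty\Big|\sum_{k=1}^n(-1)^kV_ke^{r_kx}\Big|\,dx$; (iii) if, for some $1\le p<n$ (after labeling the roots accordingly), $\operatorname{Re} r_k>0$ for $1\le k\le p$ and $\operatorname{Re} r_k<0$ for $p+1\le k\le n$: $K_D=\frac{1}{|V|}\int_0^\infty\Big(\Big|\sum_{k=1}^p(-1)^kV_ke^{-r_kx}\Big|+\Big|\sum_{k=p+1}^n(-1)^kV_ke^{r_kx}\Big|\Big)dx$.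
   Context: $\mathcal{C}^n(\mathbb{R},X)$ is the space of $n$ times differentiable functions $\mathbb{R}\to X$ with continuous $n$-th derivative, $\mathcal{C}(\mathbb{R},X)=\mathcal{C}^0(\mathbb{R},X)$; both are equipped with the gauge $\|f\|_\infty=\sup_{t\in\mathbb{R}}\|f(t)\|\in[0,\infty]$. For numbers $x_1,\ldots,x_m$, $V(x_1,\ldots,x_m)=\det(x_j^{i-1})_{1\le i,j\le m}=\prod_{1\le i<j\le m}(x_j-x_i)$ is the Vandermonde determinant (equal to $1$ when $m\le 1$). $\operatorname{Ker}D=\{y: D(y)=0\}$. A number $K\ge0$ is an Ulam constant of $D$ if for every $\varepsilon>0$ and every $y\in\mathcal{C}^n(\mathbb{R},X)$ with $\|D(y)\|_\infty\le\varepsilon$ there exists $z\in\operatorname{Ker}D$ with $\|y-z\|_\infty\le K\varepsilon$; $D$ is Ulam stable if it has an Ulam constant. $K_D$ denotes the infimum of all Ulam constants of $D$; when this infimum is itself an Ulam constant it is called the best Ulam constant of $D$.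
   Formalization: The Banach space X is assumed to be nonzero; for X = {0} every K ≥ 0 is an Ulam constant, so K_D = 0, while the stated formulas give positive numbers. *)

theory Defs
  imports "HOL-Analysis.Analysis"
begin

class scaleC =
  fixes scaleC :: "complex \<Rightarrow> 'a \<Rightarrow> 'a" (infixr \<open>*\<^sub>C\<close> 75)

class complex_vector = scaleC + real_vector +
  assumes scaleC_add_right: "c *\<^sub>C (x + y) = c *\<^sub>C x + c *\<^sub>C y"
    and scaleC_add_left: "(b + c) *\<^sub>C x = b *\<^sub>C x + c *\<^sub>C x"
    and scaleC_scaleC: "b *\<^sub>C (c *\<^sub>C x) = (b * c) *\<^sub>C x"
    and scaleC_one: "1 *\<^sub>C x = x"
    and scaleC_of_real: "complex_of_real r *\<^sub>C x = r *\<^sub>R x"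

class complex_normed_vector = complex_vector + real_normed_vector +
  assumes norm_scaleC: "norm (c *\<^sub>C x) = cmod c * norm x"

fun hderiv :: "nat \<Rightarrow> (real \<Rightarrow> 'a::real_normed_vector) \<Rightarrow> real \<Rightarrow> 'a" where
  "hderiv 0 y = y"
| "hderiv (Suc k) y = (\<lambda>t. vector_derivative (hderiv k y) (at t))"

definition Cn :: "nat \<Rightarrow> (real \<Rightarrow> 'a::real_normed_vector) set" where
  "Cn n = {y. (\<forall>k<n. \<forall>t. hderiv k y differentiable (at t))
              \<and> continuous_on UNIV (hderiv n y)}"

definition sup_gauge :: "(real \<Rightarrow> 'a::real_normed_vector) \<Rightarrow> ennreal" where
  "sup_gauge f = (SUP t. ennreal (norm (f t)))"

definition lin_op :: "nat \<Rightarrow> (nat \<Rightarrow> complex) \<Rightarrow> (real \<Rightarrow> 'a::complex_normed_vector) \<Rightarrow> real \<Rightarrow> 'a" where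
  "lin_op n a y = (\<lambda>t. hderiv n y t + (\<Sum>j=1..n. a j *\<^sub>C hderiv (n - j) y t))"

definition ulam_constant :: "nat \<Rightarrow> (nat \<Rightarrow> complex) \<Rightarrow> 'a::complex_normed_vector itself \<Rightarrow> real \<Rightarrow> bool" where
  "ulam_constant n a TYPE('a) K \<longleftrightarrow> K \<ge> 0 \<and>
     (\<forall>\<epsilon>>0. \<forall>y::real \<Rightarrow> 'a. y \<in> Cn n \<and> sup_gauge (lin_op n a y) \<le> ennreal \<epsilon> \<longrightarrow>
        (\<exists>z. z \<in> Cn n \<and> lin_op n a z = (\<lambda>_. 0) \<and>
             sup_gauge (\<lambda>t. y t - z t) \<le> ennreal (K * \<epsilon>)))"

definition K_D :: "nat \<Rightarrow> (nat \<Rightarrow> complex) \<Rightarrow> 'a::complex_normed_vector itself \<Rightarrow> real" where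
  "K_D n a T = Inf {K. ulam_constant n a T K}"

definition vandermonde :: "complex list \<Rightarrow> complex" where
  "vandermonde xs = (\<Prod>(i,j)\<in>{(i,j). i < j \<and> j < length xs}. xs ! j - xs ! i)"

end

theory Submission
  imports Defs "HOL-Computational_Algebra.Polynomial" "HOL-Real_Asymp.Real_Asymp"
begin

text \<open>
  Let \<open>Q\<^sub>k(x) = P(x) / (x - r\<^sub>k)\<close> and \<open>c\<^sub>k = 1 / Q\<^sub>k(r\<^sub>k)\<close>. If \<open>D y = f\<close>, then \<open>w\<^sub>k = Q\<^sub>k(d/dt) y\<close>
  solves \<open>w\<^sub>k' = r\<^sub>k w\<^sub>k + f\<close>, and Lagrange interpolation gives \<open>y = \<Sum>\<^sub>k c\<^sub>k w\<^sub>k\<close>. For bounded \<open>f\<close>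
  the function \<open>exp (- r\<^sub>k t) w\<^sub>k(t)\<close> converges to some \<open>v\<^sub>k\<close> at \<open>- \<infinity>\<close> if \<open>Re r\<^sub>k < 0\<close> and at \<open>+ \<infinity>\<close> otherwise.
  Subtracting the kernel element \<open>\<Sum>\<^sub>k exp (r\<^sub>k t) c\<^sub>k v\<^sub>k\<close> from \<open>y\<close> leaves the convolution \<open>G * f\<close>
  with Green's function \<open>G\<close>, which is a limit of integrals over bounded intervals, so that no
  integration theory on unbounded intervals is needed in \<open>X\<close>. Hence the \<open>L\<^sup>1\<close> norm of \<open>G\<close> is an Ulam constant.

  It is the best one: a nonzero kernel element is unbounded, so for a bounded \<open>y\<close> the approximating
  solution is \<open>0\<close>. Taking for \<open>f\<close> continuous approximations of the conjugate phase of \<open>G (- t)\<close>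
  times a unit vector, \<open>\<parallel>(G * f) 0\<parallel>\<close> tends to the \<open>L\<^sup>1\<close> norm. The Vandermonde quotients are the \<open>c\<^sub>k\<close> up to sign.
\<close>

subsection \<open>Complex scalar multiplication and iterated derivatives\<close>

lemma bounded_bilinear_scaleC:
  "bounded_bilinear (scaleC :: complex \<Rightarrow> 'a \<Rightarrow> 'a::complex_normed_vector)"
proof
  fix a b :: complex and x y :: 'a and s :: real
  show "(s *\<^sub>R a) *\<^sub>C x = s *\<^sub>R (a *\<^sub>C x)"
    by (metis scaleC_of_real scaleC_scaleC scaleR_conv_of_real)
  show "a *\<^sub>C (s *\<^sub>R x) = s *\<^sub>R (a *\<^sub>C x)"
    by (metis scaleC_of_real scaleC_scaleC mult.commute)
  show "\<exists>K. \<forall>a (x::'a). norm (a *\<^sub>C x) \<le> norm a * norm x * K"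
    by (intro exI[of _ 1]) (simp add: norm_scaleC)
qed (simp_all add: scaleC_add_right scaleC_add_left)

interpretation scaleC: bounded_bilinear
  "scaleC :: complex \<Rightarrow> 'a \<Rightarrow> 'a::complex_normed_vector"
  by (rule bounded_bilinear_scaleC)

lemmas [simp] = scaleC_one scaleC_scaleC scaleC.zero_left scaleC.zero_right

lemma exp_linear_has_vector_derivative [derivative_intros]:
  "((\<lambda>x. exp (c * complex_of_real x)) has_vector_derivative c * exp (c * of_real t)) (at t within S)"
  by (rule has_vector_derivative_real_field)
    (auto intro!: derivative_eq_intros simp: mult.commute)

lemma exp_scaleC_has_vector_derivative:
  fixes w :: "real \<Rightarrow> 'a::complex_normed_vector"
  assumes "(w has_vector_derivative w') (at t within S)"
  shows "((\<lambda>t. exp (c * of_real t) *\<^sub>C w t) has_vector_derivative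
    exp (c * of_real t) *\<^sub>C (c *\<^sub>C w t + w')) (at t within S)"
  by (rule has_vector_derivative_eq_rhs
        [OF scaleC.has_vector_derivative[OF exp_linear_has_vector_derivative assms]])
    (simp add: scaleC_add_right algebra_simps)

section \<open>Iterated derivatives and the spaces \<open>Cn\<close>\<close>

lemma hderiv_has_vector_derivative:
  assumes "y \<in> Cn n" "k < n"
  shows "(hderiv k y has_vector_derivative hderiv (Suc k) y t) (at t)"
  using assms by (simp add: Cn_def vector_derivative_works[symmetric])

text \<open>Derivatives are unique, so a chain of successive derivatives starting at
  \<open>y\<close> can only consist of the iterated derivatives. Concrete functions are handled by
  exhibiting such a chain.\<close>

lemma hderiv_eqI:
  assumes "g 0 = y" "\<And>k t. k < n \<Longrightarrow> (g k has_vector_derivative g (Suc k) t) (at t)" "k \<le> n"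
  shows "hderiv k y = g k"
  using \<open>k \<le> n\<close>
proof (induction k)
  case (Suc k)
  then have "hderiv k y = g k" by simp
  then show ?case
    using assms(2)[of k] Suc.prems by (intro ext) (simp add: vector_derivative_at)
qed (simp add: assms(1))

lemma CnI:
  assumes "g 0 = y" "\<And>k t. k < n \<Longrightarrow> (g k has_vector_derivative g (Suc k) t) (at t)"
    and "continuous_on UNIV (g n)"
  shows "y \<in> Cn n"
  unfolding Cn_def
  using assms(3) differentiableI_vector[OF assms(2)] hderiv_eqI[of g y n, OF assms(1,2)]
  by simp

lemma continuous_on_hderiv:
  assumes "y \<in> Cn n" "k \<le> n"
  shows "continuous_on UNIV (hderiv k y)"
proof (cases "k = n")
  case False
  then show ?thesis
    using assms hderiv_has_vector_derivative[OF assms(1), of k]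
    by (intro continuous_at_imp_continuous_on) (auto intro: has_vector_derivative_continuous)
qed (use assms in \<open>simp add: Cn_def\<close>)

lemma
  assumes "y \<in> Cn n" "z \<in> Cn n"
  shows Cn_diff: "(\<lambda>t. y t - z t) \<in> Cn n"
    and hderiv_diff: "k \<le> n \<Longrightarrow> hderiv k (\<lambda>t. y t - z t) = (\<lambda>t. hderiv k y t - hderiv k z t)"
proof -
  let ?g = "\<lambda>k t. hderiv k y t - hderiv k z t"
  have 1: "?g 0 = (\<lambda>t. y t - z t)" by simp
  have 2: "(?g k has_vector_derivative ?g (Suc k) t) (at t)" if "k < n" for k t
    using assms that by (intro derivative_intros hderiv_has_vector_derivative)
  show "(\<lambda>t. y t - z t) \<in> Cn n"
    by (rule CnI[of ?g, OF 1 2]) (use assms in \<open>auto intro!: continuous_intros continuous_on_hderiv\<close>)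
  show "k \<le> n \<Longrightarrow> hderiv k (\<lambda>t. y t - z t) = ?g k"
    by (rule hderiv_eqI[of ?g, OF 1 2])
qed

lemma sup_gauge_le_iff:
  assumes "0 \<le> C"
  shows "sup_gauge f \<le> ennreal C \<longleftrightarrow> (\<forall>t. norm (f t) \<le> C)"
  using assms by (auto simp: sup_gauge_def SUP_le_iff)

text \<open>For \<open>degree p \<le> n\<close> this is p(d/dt) y. The summation range depends on
  \<open>n\<close> alone, which makes it linear in \<open>p\<close> over all polynomials.\<close>

definition poly_op ::
    "nat \<Rightarrow> complex poly \<Rightarrow> (real \<Rightarrow> 'a::complex_normed_vector) \<Rightarrow> real \<Rightarrow> 'a" where
  "poly_op n p y t = (\<Sum>i\<le>n. coeff p i *\<^sub>C hderiv i y t)"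

lemma poly_op_add: "poly_op n (p + q) y t = poly_op n p y t + poly_op n q y t"
  by (simp add: poly_op_def scaleC_add_left sum.distrib)

lemma poly_op_smult: "poly_op n (smult c p) y t = c *\<^sub>C poly_op n p y t"
  by (simp add: poly_op_def scaleC.sum_right)

lemma poly_op_0 [simp]: "poly_op n 0 y t = 0"
  by (simp add: poly_op_def)

lemma poly_op_sum: "poly_op n (sum p A) y t = (\<Sum>k\<in>A. poly_op n (p k) y t)"
  by (induction A rule: infinite_finite_induct) (simp_all add: poly_op_add)

lemma poly_op_monom:
  assumes "m \<le> n"
  shows "poly_op n (monom c m) y t = c *\<^sub>C hderiv m y t"
proof -
  have "poly_op n (monom c m) y t = (\<Sum>i\<le>n. if i = m then c *\<^sub>C hderiv m y t else 0)"
    unfolding poly_op_def by (intro sum.cong) auto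
  then show ?thesis using assms by simp
qed

lemma poly_op_diff:
  assumes "y \<in> Cn n" "z \<in> Cn n"
  shows "poly_op n p (\<lambda>t. y t - z t) t = poly_op n p y t - poly_op n p z t"
  by (simp add: poly_op_def hderiv_diff[OF assms] scaleC.diff_right sum_subtractf)

lemma continuous_on_poly_op:
  assumes "y \<in> Cn n"
  shows "continuous_on UNIV (poly_op n p y)"
  unfolding poly_op_def
  by (intro continuous_intros scaleC.continuous_on continuous_on_hderiv[OF assms]) auto

text \<open>\<open>pCons 0 q\<close> multiplies \<open>q\<close> by the indeterminate, which stands
  for d/dt; the degree bound keeps the product within order \<open>n\<close>, so truncation loses
  nothing.\<close>

lemma poly_op_has_vector_derivative:
  assumes y: "y \<in> Cn n" and deg: "degree q < n"
  shows "(poly_op n q y has_vector_derivative poly_op n (pCons 0 q) y t) (at t)"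
proof -
  obtain m where n: "n = Suc m" using deg by (cases n) auto
  have c: "coeff q (Suc m) = 0" using deg n by (simp add: coeff_eq_0)
  have l: "poly_op n q y = (\<lambda>t. \<Sum>i\<le>m. coeff q i *\<^sub>C hderiv i y t)"
    by (simp add: poly_op_def n c fun_eq_iff)
  have r: "poly_op n (pCons 0 q) y t = (\<Sum>i\<le>m. coeff q i *\<^sub>C hderiv (Suc i) y t)"
    unfolding poly_op_def n sum.atMost_Suc_shift by (simp del: hderiv.simps)
  show ?thesis
    unfolding l r using hderiv_has_vector_derivative[OF y] n
    by (intro has_vector_derivative_sum bounded_linear.has_vector_derivative[OF scaleC.bounded_linear_right])
       (simp del: hderiv.simps)
qed

lemma continuous_on_has_vector_derivative:
  "(\<And>t. (g has_vector_derivative g' t) (at t)) \<Longrightarrow> continuous_on UNIV g"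
  by (intro continuous_at_imp_continuous_on) (auto intro: has_vector_derivative_continuous)

subsection \<open>Exponential sums and first-order equations\<close>

lemma exp_solution:
  fixes w :: "real \<Rightarrow> 'a::complex_normed_vector"
  assumes "\<And>t. (w has_vector_derivative c *\<^sub>C w t) (at t)"
  shows "w t = exp (c * of_real t) *\<^sub>C w 0"
proof -
  have "((\<lambda>t. exp (- c * of_real t) *\<^sub>C w t) has_vector_derivative 0) (at t)" for t
    by (rule has_vector_derivative_eq_rhs[OF exp_scaleC_has_vector_derivative[OF assms]])
      (simp add: scaleC.minus_left)
  then obtain v where v: "\<And>t. exp (- c * of_real t) *\<^sub>C w t = v"
    using has_vector_derivative_zero_constant[of UNIV "\<lambda>t. exp (- c * of_real t) *\<^sub>C w t"] by auto
  have "w t = exp (c * of_real t) *\<^sub>C (exp (- c * of_real t) *\<^sub>C w t)"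
    by (simp add: exp_add[symmetric])
  with v[of t] v[of 0] show ?thesis by simp
qed

text \<open>At \<open>t = k / Re s\<close> the exponential has modulus exp k \<ge> k, whatever the
  sign of \<open>Re s\<close>, so a nonzero \<open>u\<close> breaks any bound.\<close>

lemma bounded_exp_scaleC_imp_0:
  fixes u :: "'a::complex_normed_vector"
  assumes re: "Re s \<noteq> 0" and b: "\<And>t. norm (exp (s * complex_of_real t) *\<^sub>C u) \<le> M"
  shows "u = 0"
proof (rule ccontr)
  assume "u \<noteq> 0"
  obtain k :: nat where k: "real k * norm u > M"
    using \<open>u \<noteq> 0\<close> reals_Archimedean3[of "norm u"] by auto
  have "real k \<le> exp (real k)" using exp_ge_add_one_self[of "real k"] by linarith
  then have "real k * norm u \<le> norm (exp (s * complex_of_real (k / Re s)) *\<^sub>C u)"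
    using re by (simp add: norm_scaleC mult_right_mono)
  with b[of "k / Re s"] k show False by linarith
qed

lemma exp_linear_separates:
  assumes "r \<noteq> (s::complex)"
  shows "\<exists>h. exp (r * complex_of_real h) \<noteq> exp (s * of_real h)"
proof (rule ccontr)
  assume "\<not> ?thesis"
  then have "(\<lambda>h. exp (r * complex_of_real h)) = (\<lambda>h. exp (s * of_real h))" by auto
  with exp_linear_has_vector_derivative[of r 0 UNIV] exp_linear_has_vector_derivative[of s 0 UNIV]
  have "r * exp (r * of_real 0) = s * exp (s * of_real 0)"
    using vector_derivative_unique_at by metis
  with assms show False by simp
qed

text \<open>Induction over the frequencies: for the sum z, the combination z(t + h) - exp(q h) z(t)
  is again bounded and has lost the frequency \<open>q\<close>, while the coefficient at
  \<open>r\<close> is multiplied by exp(r h) - exp(q h).\<close>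

lemma bounded_exp_sum_imp_0:
  fixes u :: "complex \<Rightarrow> 'a::complex_normed_vector"
  assumes "finite S" "\<And>s. s \<in> S \<Longrightarrow> Re s \<noteq> 0"
    and "\<And>t. norm (\<Sum>s\<in>S. exp (s * complex_of_real t) *\<^sub>C u s) \<le> M" "s \<in> S"
  shows "u s = 0"
  using assms
proof (induction S arbitrary: u M s rule: finite_induct)
  case (insert q S)
  define E where "E r t = exp (r * complex_of_real t)" for r t
  have E_add: "E r (t + h) = E r t * E r h" for r t h
    by (simp add: E_def exp_add[symmetric] algebra_simps)
  let ?z = "\<lambda>t. \<Sum>s\<in>insert q S. E s t *\<^sub>C u s"
  have S: "u r = 0" if r: "r \<in> S" for r
  proof -
    from r insert.hyps have "r \<noteq> q" by auto
    \<comment> \<open>The shift depends on \<open>r\<close>: only the factor at the frequency under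
      consideration has to be nonzero.\<close>
    then obtain h where h: "E r h \<noteq> E q h" using exp_linear_separates unfolding E_def by blast
    have eq: "?z (t + h) - E q h *\<^sub>C ?z t = (\<Sum>s\<in>S. E s t *\<^sub>C ((E s h - E q h) *\<^sub>C u s))" for t
      using insert.hyps
      by (simp add: E_add scaleC.diff_left scaleC_add_right scaleC.sum_right
          sum_subtractf[symmetric] scaleC.diff_right mult.commute)
    have "norm (\<Sum>s\<in>S. E s t *\<^sub>C ((E s h - E q h) *\<^sub>C u s)) \<le> M + cmod (E q h) * M" for t
      unfolding eq[symmetric] using insert.prems(2)[of "t + h"] insert.prems(2)[of t]
      by (intro order_trans[OF norm_triangle_ineq4] add_mono)
        (auto simp del: sum.insert simp: norm_scaleC E_def intro!: mult_left_mono)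
    from insert.IH[OF _ this[unfolded E_def] r] insert.prems(1)
    have "(E r h - E q h) *\<^sub>C u r = 0" by (simp add: E_def)
    then have "(1 / (E r h - E q h)) *\<^sub>C ((E r h - E q h) *\<^sub>C u r) = 0" by (simp del: scaleC_scaleC)
    with h show ?thesis by simp
  qed
  have "norm (exp (q * complex_of_real t) *\<^sub>C u q) \<le> M" for t
    using insert.prems(2)[of t] insert.hyps S by simp
  then have "u q = 0" using bounded_exp_scaleC_imp_0 insert.prems(1) by blast
  with S insert.prems(3) show ?case by auto
qed simp

text \<open>The derivative exp(-c s) f(s) of h(s) = exp(-c s) w(s) is dominated by a function
  integrable at minus infinity because \<open>Re c < 0\<close>. So h has a limit \<open>v\<close>
  there, and the integral over [0, m] is exactly w(t) - exp(c t) h(t - m).\<close>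

lemma first_order_tail_left:
  fixes w f :: "real \<Rightarrow> 'a::{complex_normed_vector,banach}"
  assumes re: "Re c < 0"
    and w: "\<And>t. (w has_vector_derivative c *\<^sub>C w t + f t) (at t)"
    and f: "\<And>t. norm (f t) \<le> \<epsilon>"
  obtains v where "\<And>t. (\<lambda>m. integral {0..real m} (\<lambda>x. exp (c * of_real x) *\<^sub>C f (t - x)))
    \<longlonglongrightarrow> w t - exp (c * of_real t) *\<^sub>C v"
proof -
  define h where "h s = exp (- c * of_real s) *\<^sub>C w s" for s
  \<comment> \<open>Chosen so that C exp(- Re c s) is the antiderivative of \<epsilon> exp(- Re c s)
    that vanishes at minus infinity.\<close>
  define C where "C = \<epsilon> / - Re c"
  have h': "(h has_vector_derivative exp (- c * of_real s) *\<^sub>C f s) (at s)" for s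
    unfolding h_def
    by (rule has_vector_derivative_eq_rhs[OF exp_scaleC_has_vector_derivative[OF w]])
      (simp add: scaleC.minus_left)
  have E: "((\<lambda>s. C * exp (- Re c * s)) has_vector_derivative \<epsilon> * exp (- Re c * s)) (at s)" for s
    unfolding has_real_derivative_iff_has_vector_derivative[symmetric]
    using re by (auto intro!: derivative_eq_intros simp: C_def)
  have "0 \<le> \<epsilon>" using f[of 0] norm_ge_zero order_trans by blast
  then have "0 \<le> C" using re by (simp add: C_def divide_nonneg_neg)
  have hb: "norm (h s - h s') \<le> C * exp (- Re c * s)" if "s' \<le> s" for s s'
  proof (cases "s' = s")
    case False
    with that have "s' < s" by simp
    then have "norm (h s - h s') \<le> C * exp (- Re c * s) - C * exp (- Re c * s')"
    proof (rule differentiable_bound_general)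
      show "continuous_on {s'..s} h"
        using continuous_on_has_vector_derivative[OF h'] continuous_on_subset by blast
      show "continuous_on {s'..s} (\<lambda>s. C * exp (- Re c * s))"
        by (intro continuous_intros)
      show "norm (exp (- c * of_real x) *\<^sub>C f x) \<le> \<epsilon> * exp (- Re c * x)" for x
        using f by (simp add: norm_scaleC mult.commute)
    qed (rule h' E)+
    then show ?thesis using \<open>0 \<le> C\<close> by (smt (verit) mult_nonneg_nonneg exp_ge_zero)
  qed (use \<open>0 \<le> C\<close> in simp)
  have tail: "(\<lambda>m. C * exp (- Re c * (t - real m))) \<longlonglongrightarrow> 0" for t
    using re by real_asymp
  have "Cauchy (\<lambda>m. h (- real m))"
  proof (rule metric_CauchyI)
    fix e :: real assume "0 < e"
    have "eventually (\<lambda>m. C * exp (- Re c * (0 - real m)) < e) sequentially"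
      using order_tendstoD(2)[OF tail \<open>0 < e\<close>] .
    then obtain M where M: "\<And>m. m \<ge> M \<Longrightarrow> C * exp (- Re c * (0 - real m)) < e"
      by (auto simp: eventually_sequentially)
    have *: "dist (h (- real m)) (h (- real k)) < e" if "m \<ge> M" "k \<ge> m" for m k
      using hb[of "- real k" "- real m"] M[of m] that by (simp add: dist_norm)
    show "\<exists>M. \<forall>m\<ge>M. \<forall>k\<ge>M. dist (h (- real m)) (h (- real k)) < e"
      using * by (metis dist_commute nle_le)
  qed
  \<comment> \<open>Completeness provides the limit, at first only along the integers
    \<open>- m\<close>.\<close>
  then obtain v where v: "(\<lambda>m. h (- real m)) \<longlonglongrightarrow> v"
    using Cauchy_convergent_iff convergent_def by blast
  \<comment> \<open>An estimate at every real \<open>s\<close>, by which the shifted sequences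
    \<open>t - m\<close> lead to the same \<open>v\<close> for all \<open>t\<close>.\<close>
  have hv: "norm (h s - v) \<le> C * exp (- Re c * s)" for s
  proof (rule tendsto_upperbound)
    show "(\<lambda>m. norm (h s - h (- real m))) \<longlonglongrightarrow> norm (h s - v)"
      by (intro tendsto_intros v)
    show "eventually (\<lambda>m. norm (h s - h (- real m)) \<le> C * exp (- Re c * s)) sequentially"
      using eventually_ge_at_top[of "nat \<lceil>- s\<rceil>"] by eventually_elim (rule hb, linarith)
  qed simp
  have lim: "(\<lambda>m. h (t - real m)) \<longlonglongrightarrow> v" for t
    by (rule LIM_zero_cancel, rule Lim_null_comparison[OF always_eventually tail[of t]])
      (use hv in auto)
  have int: "integral {0..real m} (\<lambda>x. exp (c * of_real x) *\<^sub>C f (t - x))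
    = w t - exp (c * of_real t) *\<^sub>C h (t - real m)" for t m
  proof -
    have "((\<lambda>x. exp (c * of_real x) *\<^sub>C f (t - x)) has_integral
       - (exp (c * of_real (real m)) *\<^sub>C w (t - real m)) - - (exp (c * of_real 0) *\<^sub>C w (t - 0)))
       {0..real m}"
    proof (rule fundamental_theorem_of_calculus)
      fix x
      have "((\<lambda>x. w (t - x)) has_vector_derivative - (c *\<^sub>C w (t - x) + f (t - x)))
        (at x within {0..real m})"
        by (rule has_vector_derivative_at_within,
            rule has_vector_derivative_eq_rhs[OF vector_diff_chain_at[OF _ w, unfolded comp_def]])
          (auto intro!: derivative_eq_intros)
      from has_vector_derivative_minus[OF exp_scaleC_has_vector_derivative[OF this, of c]]
      show "((\<lambda>x. - (exp (c * of_real x) *\<^sub>C w (t - x))) has_vector_derivative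
        exp (c * of_real x) *\<^sub>C f (t - x)) (at x within {0..real m})"
        by (simp add: scaleC.minus_right)
    qed simp
    then show ?thesis
      by (auto simp: h_def exp_add[symmetric] algebra_simps dest!: integral_unique)
  qed
  show thesis
    by (rule that[of v], unfold int)
      (intro tendsto_intros bounded_linear.tendsto[OF scaleC.bounded_linear_right] lim)
qed

text \<open>Time reversal: \<open>w (- t)\<close> solves the equation with coefficient
  \<open>- c\<close> and forcing \<open>- f (- t)\<close>, which is the previous case.\<close>

lemma first_order_tail_right:
  fixes w f :: "real \<Rightarrow> 'a::{complex_normed_vector,banach}"
  assumes re: "Re c > 0"
    and w: "\<And>t. (w has_vector_derivative c *\<^sub>C w t + f t) (at t)"
    and f: "\<And>t. norm (f t) \<le> \<epsilon>"
  obtains v where "\<And>t. (\<lambda>m. - integral {0..real m} (\<lambda>x. exp (- c * of_real x) *\<^sub>C f (t + x)))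
    \<longlonglongrightarrow> w t - exp (c * of_real t) *\<^sub>C v"
proof -
  have w': "((\<lambda>t. w (- t)) has_vector_derivative (- c) *\<^sub>C w (- t) + - f (- t)) (at t)" for t
    by (rule has_vector_derivative_eq_rhs[OF vector_diff_chain_at[OF _ w, unfolded comp_def]])
      (auto intro!: derivative_eq_intros simp: scaleC.minus_left)
  obtain v where
    v: "\<And>t. (\<lambda>m. integral {0..real m} (\<lambda>x. exp (- c * of_real x) *\<^sub>C (- f (- (t - x)))))
      \<longlonglongrightarrow> w (- t) - exp (- c * of_real t) *\<^sub>C v"
    by (rule first_order_tail_left[of "- c" "\<lambda>t. w (- t)" "\<lambda>t. - f (- t)" \<epsilon>])
      (use re w' f in auto)
  show thesis
    by (rule that[of v]) (use v[of "- t" for t] in \<open>simp add: scaleC.minus_right add.commute\<close>)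
qed

subsection \<open>Partial fractions\<close>

locale hyperbolic_roots =
  fixes n :: nat and r :: "nat \<Rightarrow> complex"
  assumes distinct: "inj_on r {1..n}"
    and nonzero_re: "\<And>k. k \<in> {1..n} \<Longrightarrow> Re (r k) \<noteq> 0"
begin

definition P :: "complex poly" where
  "P = (\<Prod>k=1..n. [:- r k, 1:])"

definition Q :: "nat \<Rightarrow> complex poly" where
  "Q k = (\<Prod>j\<in>{1..n}-{k}. [:- r j, 1:])"

definition c :: "nat \<Rightarrow> complex" where
  "c k = 1 / (\<Prod>j\<in>{1..n}-{k}. r k - r j)"

text \<open>In this form the factor x - r_k turns into a first-order equation:
  \<open>pCons 0\<close> is differentiation, the other term multiplication by
  \<open>- r k\<close>.\<close>

lemma P_eq:
  assumes "k \<in> {1..n}"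
  shows "P = pCons 0 (Q k) + smult (- r k) (Q k)"
proof -
  have "P = [:- r k, 1:] * Q k"
    unfolding P_def Q_def using assms by (intro prod.remove) auto
  then show ?thesis by simp
qed

lemma degree_Q: "k \<in> {1..n} \<Longrightarrow> degree (Q k) = n - 1"
  unfolding Q_def by (subst degree_prod_eq_sum_degree) auto

lemma poly_Q: "poly (Q k) x = (\<Prod>j\<in>{1..n}-{k}. x - r j)"
  by (simp add: Q_def poly_prod)

lemma coeff_Q:
  assumes "k \<in> {1..n}"
  shows "coeff (Q k) (n - 1) = 1"
  unfolding degree_Q[OF assms, symmetric] unfolding Q_def lead_coeff_prod by simp

text \<open>Both sides have degree below \<open>n\<close> and agree at the \<open>n\<close> distinct
  roots, since \<open>c k\<close> scales \<open>Q k\<close> to \<open>1\<close> at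
  \<open>r k\<close> and \<open>Q k\<close> vanishes at the other roots. The case
  \<open>j = 0\<close> reconstructs \<open>y\<close>; the leading coefficients give the power
  sums.\<close>

lemma lagrange_interpolation:
  assumes "j < n"
  shows "(\<Sum>k=1..n. smult (c k * r k ^ j) (Q k)) = monom 1 j"
proof (rule poly_eqI_degree[of "r ` {1..n}"])
  have card: "card (r ` {1..n}) = n" using distinct by (simp add: card_image)
  show "degree (monom (1::complex) j) < card (r ` {1..n})"
    unfolding card using assms by (simp add: degree_monom_eq)
  have "degree (\<Sum>k=1..n. smult (c k * r k ^ j) (Q k)) \<le> n - 1"
    by (intro degree_sum_le order_trans[OF degree_smult_le]) (simp_all add: degree_Q)
  then show "degree (\<Sum>k=1..n. smult (c k * r k ^ j) (Q k)) < card (r ` {1..n})"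
    using assms card by linarith
  fix x assume "x \<in> r ` {1..n}"
  then obtain i where i: "i \<in> {1..n}" "x = r i" by auto
  have 0: "poly (Q k) (r i) = 0" if "k \<noteq> i" for k
    unfolding poly_Q using i that by (intro prod_zero) auto
  have "poly (Q i) (r i) \<noteq> 0"
    unfolding poly_Q using i(1) by (auto dest: inj_onD[OF distinct])
  then have 1: "c i * poly (Q i) (r i) = 1" by (simp add: c_def poly_Q)
  have "poly (\<Sum>k=1..n. smult (c k * r k ^ j) (Q k)) x
      = (\<Sum>k=1..n. if k = i then r i ^ j else 0)"
    unfolding poly_sum i(2) using 1 by (intro sum.cong) (auto simp: 0 algebra_simps)
  also have "\<dots> = poly (monom 1 j) x" using i by (simp add: poly_monom)
  finally show "poly (\<Sum>k=1..n. smult (c k * r k ^ j) (Q k)) x = poly (monom 1 j) x" .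
qed

lemma sum_c_power:
  assumes "j < n"
  shows "(\<Sum>k=1..n. c k * r k ^ j) = (if j = n - 1 then 1 else 0)"
  using arg_cong[OF lagrange_interpolation[OF assms], of "\<lambda>p. coeff p (n - 1)"]
  by (simp add: coeff_sum coeff_Q del: One_nat_def)

section \<open>Decoupling into first-order equations and superposition\<close>

lemma factor_has_vector_derivative:
  assumes "y \<in> Cn n" "k \<in> {1..n}"
  shows "(poly_op n (Q k) y has_vector_derivative
     r k *\<^sub>C poly_op n (Q k) y t + poly_op n P y t) (at t)"
proof -
  have "degree (Q k) < n" using degree_Q[OF assms(2)] assms(2) by auto
  from poly_op_has_vector_derivative[OF assms(1) this, of t] show ?thesis
    unfolding P_eq[OF assms(2)] poly_op_add poly_op_smult by (simp add: scaleC.minus_left)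
qed

lemma sum_factors:
  assumes "n \<ge> 1"
  shows "(\<Sum>k=1..n. c k *\<^sub>C poly_op n (Q k) y t) = y t"
proof -
  have "poly_op n (\<Sum>k=1..n. smult (c k * r k ^ 0) (Q k)) y t = y t"
    using assms by (subst lagrange_interpolation) (simp_all add: poly_op_monom del: monom_eq_1)
  then show ?thesis by (simp add: poly_op_sum poly_op_smult)
qed

text \<open>Differentiating \<open>m\<close> times leaves no derivative of \<open>f\<close> behind, because
  \<open>\<Sum>\<^sub>k c\<^sub>k r\<^sub>k\<^sup>m\<close> vanishes for \<open>m < n - 1\<close>; it is \<open>1\<close> for \<open>m = n - 1\<close>.\<close>

lemma superposition:
  fixes w :: "nat \<Rightarrow> real \<Rightarrow> 'a::complex_normed_vector"
  assumes n: "n \<ge> 1"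
    and w: "\<And>k t. k \<in> {1..n} \<Longrightarrow> (w k has_vector_derivative r k *\<^sub>C w k t + f t) (at t)"
    and f: "continuous_on UNIV f"
  defines "y \<equiv> \<lambda>t. \<Sum>k=1..n. c k *\<^sub>C w k t"
  shows "y \<in> Cn n" "poly_op n P y = f"
proof -
  define g where "g m t = (\<Sum>k=1..n. (c k * r k ^ m) *\<^sub>C w k t) + (if m = n then f t else 0)" for m t
  have g0: "g 0 = y" using n by (auto simp: g_def y_def)
  have gS: "(g m has_vector_derivative g (Suc m) t) (at t)" if "m < n" for m t
  proof -
    have "((\<lambda>t. \<Sum>k=1..n. (c k * r k ^ m) *\<^sub>C w k t) has_vector_derivative
       (\<Sum>k=1..n. (c k * r k ^ m) *\<^sub>C (r k *\<^sub>C w k t + f t))) (at t)"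
      by (intro has_vector_derivative_sum w
          bounded_linear.has_vector_derivative[OF scaleC.bounded_linear_right])
    moreover have "(\<Sum>k=1..n. (c k * r k ^ m) *\<^sub>C (r k *\<^sub>C w k t + f t)) = g (Suc m) t"
      using sum_c_power[OF that] that n
      by (auto simp: g_def scaleC_add_right sum.distrib mult_ac
          scaleC.sum_left[symmetric] simp del: sum.cl_ivl_Suc One_nat_def)
    ultimately show ?thesis using that by (simp add: g_def[abs_def])
  qed
  have cont: "continuous_on UNIV (g n)"
    unfolding g_def if_P[OF refl]
    by (intro continuous_on_add continuous_on_sum f continuous_on_has_vector_derivative[OF w]
        bounded_linear.continuous_on[OF scaleC.bounded_linear_right])
  show "y \<in> Cn n" using CnI[of g, OF g0 gS cont] by simp
  have h: "hderiv m y = g m" if "m \<le> n" for m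
    using hderiv_eqI[of g, OF g0 gS that] by simp
  have "poly_op n P y t = f t" for t
  proof -
    have deg: "degree P = n"
      unfolding P_def by (subst degree_prod_eq_sum_degree) auto
    have "lead_coeff P = 1"
      unfolding P_def lead_coeff_prod by simp
    then have lead: "coeff P n = 1" by (simp add: deg)
    \<comment> \<open>After the sums are exchanged, the factor of \<open>w k\<close> is
      \<open>c k\<close> times P(r_k) = 0. What survives is \<open>f\<close>, entering at
      \<open>i = n\<close> with leading coefficient \<open>1\<close>.\<close>
    have root: "(\<Sum>i\<le>n. coeff P i * r k ^ i) = 0" if "k \<in> {1..n}" for k
    proof -
      have "poly P (r k) = 0" using that by (auto simp: P_def poly_prod)
      then show ?thesis by (simp add: poly_altdef deg)
    qed
    have "poly_op n P y t = (\<Sum>i\<le>n. coeff P i *\<^sub>C g i t)"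
      by (simp add: poly_op_def h)
    also have "\<dots> = (\<Sum>i\<le>n. \<Sum>k=1..n. (coeff P i * (c k * r k ^ i)) *\<^sub>C w k t)
       + (\<Sum>i\<le>n. if i = n then coeff P i *\<^sub>C f t else 0)"
      unfolding sum.distrib[symmetric] g_def
      by (intro sum.cong refl) (auto simp: scaleC_add_right scaleC.sum_right)
    also have "(\<Sum>i\<le>n. if i = n then coeff P i *\<^sub>C f t else 0) = f t" by (simp add: lead)
    also have "(\<Sum>i\<le>n. \<Sum>k=1..n. (coeff P i * (c k * r k ^ i)) *\<^sub>C w k t)
        = (\<Sum>k=1..n. (c k * (\<Sum>i\<le>n. coeff P i * r k ^ i)) *\<^sub>C w k t)"
      by (subst sum.swap) (simp add: scaleC.sum_left sum_distrib_left mult_ac)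
    finally show ?thesis by (simp add: root)
  qed
  then show "poly_op n P y = f" by blast
qed

text \<open>On the kernel each \<open>poly_op n (Q k) z\<close> is a pure exponential with exponent
  \<open>r k\<close>, so \<open>z\<close> is an exponential sum with frequencies off the imaginary
  axis, and boundedness kills its coefficients.\<close>

lemma bounded_kernel_eq_0:
  fixes z :: "real \<Rightarrow> 'a::complex_normed_vector"
  assumes n: "n \<ge> 1" and z: "z \<in> Cn n" "\<And>t. poly_op n P z t = 0"
    and b: "\<And>t. norm (z t) \<le> M"
  shows "z t = 0"
proof -
  let ?w = "\<lambda>k. poly_op n (Q k) z"
  have w: "?w k t = exp (r k * of_real t) *\<^sub>C ?w k 0" if "k \<in> {1..n}" for k t
    by (rule exp_solution) (use factor_has_vector_derivative[OF z(1) that] z(2) in simp)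
  \<comment> \<open>Coefficients are indexed by the roots themselves, as
    \<open>bounded_exp_sum_imp_0\<close> expects; injectivity of \<open>r\<close> recovers
    \<open>k\<close>.\<close>
  define u where "u s = (let k = the_inv_into {1..n} r s in c k *\<^sub>C ?w k 0)" for s
  have zt: "z t = (\<Sum>s\<in>r ` {1..n}. exp (s * complex_of_real t) *\<^sub>C u s)" for t
  proof -
    have "z t = (\<Sum>k=1..n. c k *\<^sub>C ?w k t)" using sum_factors[OF n, of z t] by simp
    also have "\<dots> = (\<Sum>k=1..n. exp (r k * of_real t) *\<^sub>C u (r k))"
    proof (intro sum.cong refl)
      fix k assume k: "k \<in> {1..n}"
      then show "c k *\<^sub>C ?w k t = exp (r k * of_real t) *\<^sub>C u (r k)"
        by (simp add: u_def the_inv_into_f_f[OF distinct] w[OF k, of t] mult.commute Let_def del: One_nat_def)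
    qed
    also have "\<dots> = (\<Sum>s\<in>r ` {1..n}. exp (s * complex_of_real t) *\<^sub>C u s)"
      by (simp add: sum.reindex[OF distinct] del: One_nat_def)
    finally show ?thesis .
  qed
  have "u s = 0" if "s \<in> r ` {1..n}" for s
    by (rule bounded_exp_sum_imp_0[of "r ` {1..n}" u M, OF _ _ _ that])
      (use nonzero_re b in \<open>auto simp: zt[symmetric] simp del: One_nat_def\<close>)
  then show ?thesis by (simp add: zt)
qed

end

subsection \<open>Green's function\<close>

text \<open>Domination by the separate decaying exponentials; the double minus exhibits the positive
  rate \<open>- Re (s k)\<close>.\<close>

lemma exp_sum_norm_integrable:
  assumes "finite S" "\<And>k. k \<in> S \<Longrightarrow> Re (s k) < 0"
  shows "(\<lambda>x. cmod (\<Sum>k\<in>S. d k * exp (s k * complex_of_real x))) integrable_on {0..}"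
proof (rule measurable_bounded_by_integrable_imp_integrable)
  show "(\<lambda>x. cmod (\<Sum>k\<in>S. d k * exp (s k * complex_of_real x))) \<in> borel_measurable (lebesgue_on {0..})"
    by (intro continuous_imp_measurable_on_sets_lebesgue continuous_intros) simp
  show "(\<lambda>x. \<Sum>k\<in>S. cmod (d k) * exp (- (- Re (s k)) * x)) integrable_on {0..}"
    using assms by (intro integrable_sum integrable_on_mult_right integrable_on_exp_minus_to_infinity) auto
  show "norm (cmod (\<Sum>k\<in>S. d k * exp (s k * complex_of_real x)))
      \<le> (\<Sum>k\<in>S. cmod (d k) * exp (- (- Re (s k)) * x))" for x
    by (simp, rule order_trans[OF norm_sum]) (simp add: norm_mult)
qed simp

context hyperbolic_roots
begin

definition stable :: "nat set" where
  "stable = {k \<in> {1..n}. Re (r k) < 0}"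

definition unstable :: "nat set" where
  "unstable = {k \<in> {1..n}. Re (r k) > 0}"

lemma finite_stable [simp]: "finite stable" and finite_unstable [simp]: "finite unstable"
  by (simp_all add: stable_def unstable_def)

lemma stable_unstable: "stable \<union> unstable = {1..n}" "stable \<inter> unstable = {}"
  using nonzero_re by (force simp: stable_def unstable_def)+

text \<open>Green's function \<open>G\<close> of the operator on the two half lines:
  \<open>G x = G\<^sub>+ x\<close> and \<open>G (- x) = - G\<^sub>- x\<close> for \<open>x > 0\<close>.\<close>

definition Gpos :: "real \<Rightarrow> complex" where
  "Gpos x = (\<Sum>k\<in>stable. c k * exp (r k * of_real x))"

definition Gneg :: "real \<Rightarrow> complex" where
  "Gneg x = (\<Sum>k\<in>unstable. c k * exp (- r k * of_real x))"

text \<open>The L^1 norm of Green's function over the whole line, with the negative half line folded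
  onto the positive one.\<close>

definition K0 :: real where
  "K0 = integral {0..} (\<lambda>x. cmod (Gpos x) + cmod (Gneg x))"

lemma continuous_Gpos [continuous_intros]:
  "continuous_on S f \<Longrightarrow> continuous_on S (\<lambda>x. Gpos (f x))"
  unfolding Gpos_def by (intro continuous_intros)

lemma continuous_Gneg [continuous_intros]:
  "continuous_on S f \<Longrightarrow> continuous_on S (\<lambda>x. Gneg (f x))"
  unfolding Gneg_def by (intro continuous_intros)

lemma green_norm_integrable: "(\<lambda>x. cmod (Gpos x) + cmod (Gneg x)) integrable_on {0..}"
  unfolding Gpos_def Gneg_def
  by (intro integrable_add exp_sum_norm_integrable) (auto simp: stable_def unstable_def)

lemma K0_nonneg: "0 \<le> K0"
  unfolding K0_def using green_norm_integrable by (intro integral_nonneg) auto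

lemma green_representation:
  fixes y :: "real \<Rightarrow> 'a::{complex_normed_vector,banach}"
  defines "f \<equiv> poly_op n P y"
  assumes n: "n \<ge> 1" and y: "y \<in> Cn n" and b: "\<And>t. norm (f t) \<le> \<epsilon>"
  obtains z where "z \<in> Cn n" "\<And>t. poly_op n P z t = 0"
    "\<And>t. (\<lambda>m. integral {0..real m} (\<lambda>x. Gpos x *\<^sub>C f (t - x))
        - integral {0..real m} (\<lambda>x. Gneg x *\<^sub>C f (t + x))) \<longlonglongrightarrow> y t - z t"
proof -
  let ?w = "\<lambda>k. poly_op n (Q k) y"
  \<comment> \<open>Stable components are integrated over the past of \<open>t\<close>, unstable
    ones over the future, where the respective kernels decay.\<close>
  define T where "T k t m = (if Re (r k) < 0
      then integral {0..real m} (\<lambda>x. exp (r k * of_real x) *\<^sub>C f (t - x))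
      else - integral {0..real m} (\<lambda>x. exp (- r k * of_real x) *\<^sub>C f (t + x)))" for k t m
  have w: "(?w k has_vector_derivative r k *\<^sub>C ?w k t + f t) (at t)" if "k \<in> {1..n}" for k t
    unfolding f_def by (rule factor_has_vector_derivative[OF y that])
  have "\<exists>v. \<forall>t. T k t \<longlonglongrightarrow> ?w k t - exp (r k * of_real t) *\<^sub>C v" if k: "k \<in> {1..n}" for k
  proof (cases "Re (r k) < 0")
    case True
    obtain v where "\<And>t. (\<lambda>m. integral {0..real m} (\<lambda>x. exp (r k * of_real x) *\<^sub>C f (t - x)))
        \<longlonglongrightarrow> ?w k t - exp (r k * of_real t) *\<^sub>C v"
      using first_order_tail_left[OF True w[OF k] b] by blast
    then show ?thesis using True unfolding T_def by auto
  next
    case False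
    then have re: "Re (r k) > 0" using nonzero_re[OF k] by simp
    obtain v where "\<And>t. (\<lambda>m. - integral {0..real m} (\<lambda>x. exp (- r k * of_real x) *\<^sub>C f (t + x)))
        \<longlonglongrightarrow> ?w k t - exp (r k * of_real t) *\<^sub>C v"
      using first_order_tail_right[OF re w[OF k] b] by blast
    then show ?thesis using False unfolding T_def by auto
  qed
  then obtain v where
    v: "\<And>k t. k \<in> {1..n} \<Longrightarrow> T k t \<longlonglongrightarrow> ?w k t - exp (r k * of_real t) *\<^sub>C v k"
    by metis
  \<comment> \<open>Superposition with zero forcing puts this combination of homogeneous solutions
    into the kernel.\<close>
  define z where "z t = (\<Sum>k=1..n. c k *\<^sub>C (exp (r k * of_real t) *\<^sub>C v k))" for t
  have e: "((\<lambda>t. exp (r k * of_real t) *\<^sub>C v k) has_vector_derivative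
       r k *\<^sub>C (exp (r k * of_real t) *\<^sub>C v k) + 0) (at t)" for k t
    using exp_scaleC_has_vector_derivative[OF has_vector_derivative_const[of "v k"], of "r k"]
    by (simp add: mult.commute)
  have z: "z \<in> Cn n" "poly_op n P z = (\<lambda>_. 0)"
    unfolding z_def using superposition[OF n e continuous_on_const] by auto
  have fc: "continuous_on UNIV f" unfolding f_def by (rule continuous_on_poly_op[OF y])
  have fc': "continuous_on S (\<lambda>x. f (g x))" if "continuous_on S g" for S :: "real set" and g
    using continuous_on_compose2[OF fc that] by simp
  have lim: "(\<lambda>m. \<Sum>k=1..n. c k *\<^sub>C T k t m) \<longlonglongrightarrow> y t - z t" for t
  proof -
    have "(\<lambda>m. \<Sum>k=1..n. c k *\<^sub>C T k t m)
        \<longlonglongrightarrow> (\<Sum>k=1..n. c k *\<^sub>C (?w k t - exp (r k * of_real t) *\<^sub>C v k))"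
      by (intro tendsto_sum bounded_linear.tendsto[OF scaleC.bounded_linear_right] v)
    then show ?thesis
      using sum_factors[OF n, of y t]
      by (simp add: z_def scaleC.diff_right sum_subtractf del: One_nat_def scaleC_scaleC)
  qed
  have pull: "integral {0..real m} (\<lambda>x. (\<Sum>k\<in>S. c k * exp (s k * of_real x)) *\<^sub>C f (g x))
      = (\<Sum>k\<in>S. c k *\<^sub>C integral {0..real m} (\<lambda>x. exp (s k * of_real x) *\<^sub>C f (g x)))"
    if "finite S" and g: "continuous_on {0..real m} g"
    for S m and s :: "nat \<Rightarrow> complex" and g
  proof -
    have i: "(\<lambda>x. exp (s k * of_real x) *\<^sub>C f (g x)) integrable_on {0..real m}" for k
      by (intro integrable_continuous_real scaleC.continuous_on fc' g continuous_intros)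
    note bl = scaleC.bounded_linear_right
    show ?thesis
      unfolding scaleC.sum_left scaleC_scaleC[symmetric]
      using integral_linear[OF i bl] integrable_linear[OF i bl] \<open>finite S\<close>
      by (subst integral_sum) (auto simp: comp_def simp del: scaleC_scaleC)
  qed
  have "integral {0..real m} (\<lambda>x. Gpos x *\<^sub>C f (t - x)) - integral {0..real m} (\<lambda>x. Gneg x *\<^sub>C f (t + x))
      = (\<Sum>k=1..n. c k *\<^sub>C T k t m)" for t m
  proof -
    have "integral {0..real m} (\<lambda>x. Gpos x *\<^sub>C f (t - x)) = (\<Sum>k\<in>stable. c k *\<^sub>C T k t m)"
      unfolding Gpos_def by (subst pull) (auto intro!: continuous_intros sum.cong simp: T_def stable_def)
    moreover have "integral {0..real m} (\<lambda>x. Gneg x *\<^sub>C f (t + x)) = - (\<Sum>k\<in>unstable. c k *\<^sub>C T k t m)"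
      unfolding Gneg_def sum_negf[symmetric]
      by (subst pull) (auto intro!: continuous_intros sum.cong simp: T_def unstable_def scaleC.minus_right)
    ultimately show ?thesis
      by (simp add: stable_unstable(1)[symmetric] sum.union_disjoint stable_unstable(2)
          del: One_nat_def)
  qed
  with lim have "(\<lambda>m. integral {0..real m} (\<lambda>x. Gpos x *\<^sub>C f (t - x))
        - integral {0..real m} (\<lambda>x. Gneg x *\<^sub>C f (t + x))) \<longlonglongrightarrow> y t - z t" for t
    by simp
  with z show thesis by (intro that[of z]) auto
qed

text \<open>Pointwise estimate of the integrand; enlarging [0, m] to the half line then makes the
  bound independent of \<open>m\<close> and \<open>t\<close>.\<close>

lemma green_integral_bound:
  fixes f :: "real \<Rightarrow> 'a::{complex_normed_vector,banach}"
  assumes f: "continuous_on UNIV f" and b: "\<And>t. norm (f t) \<le> \<epsilon>"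
  shows "norm (integral {0..real m} (\<lambda>x. Gpos x *\<^sub>C f (t - x))
        - integral {0..real m} (\<lambda>x. Gneg x *\<^sub>C f (t + x))) \<le> K0 * \<epsilon>"
proof -
  have fc: "continuous_on S (\<lambda>x. f (g x))" if "continuous_on S g" for S :: "real set" and g
    using continuous_on_compose2[OF f that] by simp
  have i: "(\<lambda>x. Gpos x *\<^sub>C f (t - x)) integrable_on {0..real m}"
      "(\<lambda>x. Gneg x *\<^sub>C f (t + x)) integrable_on {0..real m}"
    by (intro integrable_continuous_real scaleC.continuous_on fc continuous_intros)+
  have j: "(\<lambda>x. cmod (Gpos x) + cmod (Gneg x)) integrable_on {0..real m}"
    by (intro integrable_continuous_real continuous_intros)
  have "0 \<le> \<epsilon>" using b[of 0] norm_ge_zero order_trans by blast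
  have "norm (integral {0..real m} (\<lambda>x. Gpos x *\<^sub>C f (t - x))
        - integral {0..real m} (\<lambda>x. Gneg x *\<^sub>C f (t + x)))
      = norm (integral {0..real m} (\<lambda>x. Gpos x *\<^sub>C f (t - x) - Gneg x *\<^sub>C f (t + x)))"
    using i by (simp add: Henstock_Kurzweil_Integration.integral_diff)
  also have "\<dots> \<le> integral {0..real m} (\<lambda>x. (cmod (Gpos x) + cmod (Gneg x)) * \<epsilon>)"
  proof (rule Henstock_Kurzweil_Integration.integral_norm_bound_integral)
    show "norm (Gpos x *\<^sub>C f (t - x) - Gneg x *\<^sub>C f (t + x)) \<le> (cmod (Gpos x) + cmod (Gneg x)) * \<epsilon>"
      for x
      unfolding distrib_right using b
      by (intro order_trans[OF norm_triangle_ineq4] add_mono) (auto simp: norm_scaleC intro: mult_left_mono)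
  qed (use i j in \<open>auto intro!: integrable_diff integrable_on_mult_left\<close>)
  also have "\<dots> = integral {0..real m} (\<lambda>x. cmod (Gpos x) + cmod (Gneg x)) * \<epsilon>"
    by simp
  also have "\<dots> \<le> K0 * \<epsilon>"
    unfolding K0_def using \<open>0 \<le> \<epsilon>\<close> j green_norm_integrable
    by (intro mult_right_mono integral_subset_le) auto
  finally show ?thesis .
qed

text \<open>The uniform bound passes to the limit. The limit formula stays in the conclusion because
  the optimality proof evaluates it at \<open>t = 0\<close>.\<close>

lemma ulam_upper:
  fixes y :: "real \<Rightarrow> 'a::{complex_normed_vector,banach}"
  assumes n: "n \<ge> 1" and y: "y \<in> Cn n" and b: "\<And>t. norm (poly_op n P y t) \<le> \<epsilon>"
  obtains z where "z \<in> Cn n" "\<And>t. poly_op n P z t = 0" "\<And>t. norm (y t - z t) \<le> K0 * \<epsilon>"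
    "\<And>t. (\<lambda>m. integral {0..real m} (\<lambda>x. Gpos x *\<^sub>C poly_op n P y (t - x))
        - integral {0..real m} (\<lambda>x. Gneg x *\<^sub>C poly_op n P y (t + x))) \<longlonglongrightarrow> y t - z t"
proof -
  obtain z where z: "z \<in> Cn n" "\<And>t. poly_op n P z t = 0" and
    l: "\<And>t. (\<lambda>m. integral {0..real m} (\<lambda>x. Gpos x *\<^sub>C poly_op n P y (t - x))
        - integral {0..real m} (\<lambda>x. Gneg x *\<^sub>C poly_op n P y (t + x))) \<longlonglongrightarrow> y t - z t"
    using green_representation[OF n y b] by blast
  have "norm (y t - z t) \<le> K0 * \<epsilon>" for t
    by (rule Lim_bounded[OF tendsto_norm[OF l]])
      (use green_integral_bound[OF continuous_on_poly_op[OF y] b] in blast)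
  with z l show thesis using that by blast
qed

end

subsection \<open>Optimality\<close>

lemma antiderivative_exists:
  fixes f :: "real \<Rightarrow> complex"
  assumes "continuous_on UNIV f"
  obtains F where "\<And>t. (F has_vector_derivative f t) (at t)"
  using einterval_antiderivative[of "-\<infinity>" "\<infinity>" f] assms
  by (auto simp: continuous_on_eq_continuous_at)

context hyperbolic_roots
begin

text \<open>Variation of constants in each component. The forcing is a scalar function times a fixed
  vector, so scalar antiderivatives \<open>F k\<close> suffice.\<close>

lemma solution_exists:
  fixes u :: "'a::complex_normed_vector"
  assumes n: "n \<ge> 1" and \<phi>: "continuous_on UNIV \<phi>"
  obtains y :: "real \<Rightarrow> 'a" where "y \<in> Cn n" "poly_op n P y = (\<lambda>t. \<phi> t *\<^sub>C u)"
proof -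
  have "\<exists>F. \<forall>t. (F has_vector_derivative exp (- r k * of_real t) * \<phi> t) (at t)" for k
    by (rule antiderivative_exists[of "\<lambda>t. exp (- r k * of_real t) * \<phi> t"])
      (auto intro!: continuous_intros \<phi>)
  then obtain F where
    F: "\<And>k t. (F k has_vector_derivative exp (- r k * of_real t) * \<phi> t) (at t)"
    by metis
  have w: "((\<lambda>t. exp (r k * of_real t) *\<^sub>C (F k t *\<^sub>C u)) has_vector_derivative
      r k *\<^sub>C (exp (r k * of_real t) *\<^sub>C (F k t *\<^sub>C u)) + \<phi> t *\<^sub>C u) (at t)" for k t
    by (rule has_vector_derivative_eq_rhs[OF exp_scaleC_has_vector_derivative
          [OF bounded_linear.has_vector_derivative[OF scaleC.bounded_linear_left F]]])
      (simp add: scaleC_add_right mult_ac exp_add[symmetric] flip: mult.assoc)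
  show thesis
    by (rule that, rule superposition[OF n w], intro scaleC.continuous_on \<phi> continuous_intros,
        rule superposition[OF n w], intro scaleC.continuous_on \<phi> continuous_intros)
qed

text \<open>The extremal right hand side: it approximates the conjugate phase of \<open>G (- x)\<close>.
  The factor \<open>\<bar>x\<bar> / (\<bar>x\<bar> + \<delta>)\<close> makes it continuous at \<open>0\<close>, where \<open>G\<close> jumps if \<open>n = 1\<close>.\<close>

definition extremal :: "real \<Rightarrow> real \<Rightarrow> complex" where
  "extremal \<delta> x = (if x \<le> 0
     then cnj (Gpos (- x)) / of_real (cmod (Gpos (- x)) + \<delta>) * of_real (- x / (- x + \<delta>))
     else - cnj (Gneg x) / of_real (cmod (Gneg x) + \<delta>) * of_real (x / (x + \<delta>)))"

text \<open>The integrand of Green's integral at \<open>t = 0\<close> for the extremal right hand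
  side, without the vector factor.\<close>

definition density :: "real \<Rightarrow> real \<Rightarrow> real" where
  "density \<delta> x = ((cmod (Gpos x))\<^sup>2 / (cmod (Gpos x) + \<delta>) + (cmod (Gneg x))\<^sup>2 / (cmod (Gneg x) + \<delta>))
     * (x / (x + \<delta>))"

lemma continuous_extremal:
  assumes "\<delta> > 0"
  shows "continuous_on UNIV (extremal \<delta>)"
proof -
  have nz: "complex_of_real (cmod z + \<delta>) \<noteq> 0" for z
    using assms norm_ge_zero[of z] by (metis add_nonneg_pos less_irrefl of_real_eq_0_iff)
  have "continuous_on ({..0} \<union> {0..}) (extremal \<delta>)"
    unfolding extremal_def
    by (rule continuous_on_cases)
      (use assms nz in \<open>auto intro!: continuous_intros simp del: of_real_add of_real_divide of_real_minus\<close>)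
  moreover have "{..0} \<union> {0..} = (UNIV :: real set)" by auto
  ultimately show ?thesis by simp
qed

lemma norm_extremal_le_1:
  assumes "\<delta> > 0"
  shows "cmod (extremal \<delta> x) \<le> 1"
proof -
  have a: "a / (a + \<delta>) \<le> 1" "0 \<le> a / (a + \<delta>)" if "0 \<le> a" for a
    using assms that by (auto simp: divide_simps)
  have *: "cmod z / \<bar>cmod z + \<delta>\<bar> * \<bar>b / (b + \<delta>)\<bar> \<le> 1" if "0 \<le> b" for z b
  proof -
    have "cmod z / (cmod z + \<delta>) * (b / (b + \<delta>)) \<le> 1"
      using a[of "cmod z"] a[OF that] by (intro mult_le_one) auto
    then show ?thesis using that assms by simp
  qed
  show ?thesis
    using *[of "- x" "Gpos (- x)"] *[of x "Gneg x"]
    by (simp add: extremal_def norm_mult norm_divide del: of_real_add of_real_divide of_real_minus abs_divide)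
qed

lemma Gpos_extremal:
  assumes "\<delta> > 0" "x \<ge> 0"
  shows "Gpos x * extremal \<delta> (- x) - Gneg x * extremal \<delta> x = of_real (density \<delta> x)"
proof -
  have *: "of_real ((cmod z)\<^sup>2 / a * b) = z * (cnj z / of_real a * of_real b)" for z a b
    unfolding of_real_mult of_real_divide complex_norm_square by simp
  have "Gpos x * extremal \<delta> (- x)
      = of_real ((cmod (Gpos x))\<^sup>2 / (cmod (Gpos x) + \<delta>) * (x / (x + \<delta>)))"
    unfolding * using assms(2) by (simp add: extremal_def)
  moreover have "Gneg x * extremal \<delta> x
      = - of_real ((cmod (Gneg x))\<^sup>2 / (cmod (Gneg x) + \<delta>) * (x / (x + \<delta>)))"
  \<comment> \<open>At \<open>x = 0\<close> the definition of \<open>extremal\<close> takes its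
    first branch, which involves \<open>Gpos\<close>; there both sides vanish.\<close>
  proof (cases "x = 0")
    case False
    then show ?thesis unfolding * using assms(2) by (simp add: extremal_def)
  qed (simp add: extremal_def)
  ultimately show ?thesis
    unfolding density_def distrib_right of_real_add by simp
qed

lemma density_nonneg: "\<delta> > 0 \<Longrightarrow> x \<ge> 0 \<Longrightarrow> 0 \<le> density \<delta> x"
  by (simp add: density_def)

lemma density_le:
  assumes "\<delta> > 0" "x \<ge> 0"
  shows "density \<delta> x \<le> cmod (Gpos x) + cmod (Gneg x)"
proof -
  have a: "a\<^sup>2 / (a + \<delta>) \<le> a" "0 \<le> a\<^sup>2 / (a + \<delta>)" if "0 \<le> a" for a
    using assms that by (auto simp: divide_simps power2_eq_square algebra_simps)
  have "density \<delta> x \<le> (cmod (Gpos x) + cmod (Gneg x)) * 1"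
    unfolding density_def using a[of "cmod (Gpos x)"] a[of "cmod (Gneg x)"] assms
    by (intro mult_mono add_mono) auto
  then show ?thesis by simp
qed

lemma continuous_density:
  "\<delta> > 0 \<Longrightarrow> continuous_on {0..b} (density \<delta>)"
  unfolding density_def
  by (intro continuous_intros) (auto simp: add_nonneg_eq_0_iff)

lemma density_tendsto:
  assumes "x > 0"
  shows "(\<lambda>m. density (1 / (1 + real m)) x) \<longlonglongrightarrow> cmod (Gpos x) + cmod (Gneg x)"
proof -
  have \<delta>: "(\<lambda>m. 1 / (1 + real m)) \<longlonglongrightarrow> 0" by real_asymp
  have a: "(\<lambda>m. a\<^sup>2 / (a + 1 / (1 + real m))) \<longlonglongrightarrow> a" if "0 \<le> a" for a
  \<comment> \<open>For \<open>a = 0\<close> the limit would read 0/0, but the sequence is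
    constantly \<open>0\<close>.\<close>
  proof (cases "a = 0")
    case False
    then have "(\<lambda>m. a\<^sup>2 / (a + 1 / (1 + real m))) \<longlonglongrightarrow> a\<^sup>2 / (a + 0)"
      by (intro tendsto_intros \<delta>) auto
    then show ?thesis using False by (simp add: power2_eq_square)
  qed simp
  have "(\<lambda>m. density (1 / (1 + real m)) x)
      \<longlonglongrightarrow> (cmod (Gpos x) + cmod (Gneg x)) * (x / (x + 0))"
    unfolding density_def using assms by (intro tendsto_intros a \<delta>) auto
  then show ?thesis using assms by simp
qed

text \<open>Subtracting a kernel element from a solution with extremal forcing leaves a bounded
  \<open>y0\<close>. The approximant of \<open>y0\<close> is then a bounded kernel element, hence
  \<open>0\<close>, so \<open>K\<close> bounds \<open>y0 0\<close> itself, which is \<open>u\<close>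
  times the limit of the integrals of the density.\<close>

lemma integral_density_le:
  fixes K :: real and u :: "'a::{complex_normed_vector,banach}"
  assumes n: "n \<ge> 1" and u: "norm u = 1" and \<delta>: "\<delta> > 0"
    and ulam: "\<And>y :: real \<Rightarrow> 'a. y \<in> Cn n \<Longrightarrow> (\<And>t. norm (poly_op n P y t) \<le> 1) \<Longrightarrow>
      \<exists>z \<in> Cn n. (\<forall>t. poly_op n P z t = 0) \<and> (\<forall>t. norm (y t - z t) \<le> K)"
  shows "integral {0..real m} (density \<delta>) \<le> K"
proof -
  obtain y :: "real \<Rightarrow> 'a" where y: "y \<in> Cn n" and f: "poly_op n P y = (\<lambda>t. extremal \<delta> t *\<^sub>C u)"
    using solution_exists[OF n continuous_extremal[OF \<delta>]] by blast
  have b: "norm (poly_op n P y t) \<le> 1" for t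
    using norm_extremal_le_1[OF \<delta>] by (simp add: f norm_scaleC u)
  obtain z where z: "z \<in> Cn n" "\<And>t. poly_op n P z t = 0" "\<And>t. norm (y t - z t) \<le> K0 * 1" and
    lim: "\<And>t. (\<lambda>m. integral {0..real m} (\<lambda>x. Gpos x *\<^sub>C poly_op n P y (t - x))
        - integral {0..real m} (\<lambda>x. Gneg x *\<^sub>C poly_op n P y (t + x))) \<longlonglongrightarrow> y t - z t"
    using ulam_upper[OF n y b] by blast
  define y0 where "y0 t = y t - z t" for t
  have y0: "y0 \<in> Cn n" unfolding y0_def by (rule Cn_diff[OF y z(1)])
  have Py0: "poly_op n P y0 t = poly_op n P y t" for t
    unfolding y0_def using poly_op_diff[OF y z(1)] z(2) by simp
  obtain z' where z': "z' \<in> Cn n" "\<And>t. poly_op n P z' t = 0" "\<And>t. norm (y0 t - z' t) \<le> K"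
    using ulam[OF y0] b Py0 by metis
  have "norm (z' t) \<le> K0 + K" for t
    using norm_triangle_ineq4[of "y0 t" "y0 t - z' t"] z'(3)[of t] z(3)[of t] by (simp add: y0_def)
  then have "z' 0 = 0" by (rule bounded_kernel_eq_0[OF n z'(1,2)])
  then have y0K: "norm (y0 0) \<le> K" using z'(3)[of 0] by simp
  define I where "I m = integral {0..real m} (density \<delta>)" for m
  have di: "density \<delta> integrable_on {0..real m}" for m
    by (rule integrable_continuous_real[OF continuous_density[OF \<delta>]])
  have I0: "0 \<le> I m" for m
    unfolding I_def using di density_nonneg[OF \<delta>] by (intro integral_nonneg) auto
  have "integral {0..real m} (\<lambda>x. Gpos x *\<^sub>C poly_op n P y (0 - x))
        - integral {0..real m} (\<lambda>x. Gneg x *\<^sub>C poly_op n P y (0 + x)) = I m *\<^sub>R u" for m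
  proof -
    have fc: "continuous_on S (\<lambda>x. poly_op n P y (g x))" if "continuous_on S g" for S :: "real set" and g
      using continuous_on_compose2[OF continuous_on_poly_op[OF y] that] by simp
    have "integral {0..real m} (\<lambda>x. Gpos x *\<^sub>C poly_op n P y (0 - x))
        - integral {0..real m} (\<lambda>x. Gneg x *\<^sub>C poly_op n P y (0 + x))
      = integral {0..real m} (\<lambda>x. Gpos x *\<^sub>C poly_op n P y (0 - x) - Gneg x *\<^sub>C poly_op n P y (0 + x))"
      by (intro Henstock_Kurzweil_Integration.integral_diff[symmetric] integrable_continuous_real
          scaleC.continuous_on fc continuous_intros)
    also have "\<dots> = integral {0..real m} (\<lambda>x. density \<delta> x *\<^sub>R u)"
      by (intro Henstock_Kurzweil_Integration.integral_cong)
        (auto simp: f Gpos_extremal[OF \<delta>] scaleC_of_real simp flip: scaleC.diff_left)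
    also have "\<dots> = I m *\<^sub>R u"
      using integral_linear[OF di bounded_linear_scaleR_left] by (simp add: comp_def I_def)
    finally show ?thesis .
  qed
  with tendsto_norm[OF lim[of 0]] u I0 have "I \<longlonglongrightarrow> norm (y0 0)"
    by (simp add: y0_def)
  \<comment> \<open>The density is nonnegative, so \<open>I\<close> increases and each value lies
    below the limit.\<close>
  then have "I m \<le> norm (y0 0)"
  proof (rule tendsto_lowerbound)
    show "eventually (\<lambda>k. I m \<le> I k) sequentially"
      using eventually_ge_at_top[of m]
    proof eventually_elim
      case (elim k)
      then show ?case
        unfolding I_def using density_nonneg[OF \<delta>] by (intro integral_subset_le di) auto
    qed
  qed simp
  with y0K show ?thesis by (simp add: I_def)
qed

lemma ulam_lower:
  fixes K :: real
  assumes n: "n \<ge> 1" and X: "\<exists>x::'a::{complex_normed_vector,banach}. x \<noteq> 0"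
    and ulam: "\<And>y :: real \<Rightarrow> 'a. y \<in> Cn n \<Longrightarrow> (\<And>t. norm (poly_op n P y t) \<le> 1) \<Longrightarrow>
      \<exists>z \<in> Cn n. (\<forall>t. poly_op n P z t = 0) \<and> (\<forall>t. norm (y t - z t) \<le> K)"
  shows "K0 \<le> K"
proof -
  obtain x :: 'a where "x \<noteq> 0" using X by auto
  then have u: "norm (x /\<^sub>R norm x) = 1" by simp
  let ?h = "\<lambda>x. cmod (Gpos x) + cmod (Gneg x)"
  \<comment> \<open>The regularisation tends to \<open>0\<close> while the interval [0, m] grows, so
    one application of dominated convergence covers both.\<close>
  define d where "d m = (1 / (1 + real m))" for m
  have d: "d m > 0" for m by (simp add: d_def)
  define F where "F m x = (if x \<in> {0..real m} then density (d m) x else 0)" for m x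
  \<comment> \<open>The density vanishes at \<open>x = 0\<close> for every parameter, so the
    pointwise limit is \<open>0\<close> there; this changes the integrand of \<open>K0\<close> only
    on a null set.\<close>
  define g where "g x = (if x = 0 then 0 else ?h x)" for x
  have di: "density (d m) integrable_on {0..real m}" for m
    by (rule integrable_continuous_real[OF continuous_density[OF d]])
  have Fi: "(F m has_integral integral {0..real m} (density (d m))) {0..}" for m
    unfolding F_def using di by (subst has_integral_restrict) auto
  have "(\<lambda>m. integral {0..} (F m)) \<longlonglongrightarrow> integral {0..} g"
  proof (rule dominated_convergence(2)[OF _ green_norm_integrable])
    show "F m integrable_on {0..}" for m using Fi by blast
    show "norm (F m x) \<le> ?h x" if "x \<in> {0..}" for m x
      using density_le[OF d] density_nonneg[OF d] that by (auto simp: F_def)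
    show "(\<lambda>m. F m x) \<longlonglongrightarrow> g x" if "x \<in> {0..}" for x
    proof (cases "x = 0")
      case False
      with that have "x > 0" by simp
      have "eventually (\<lambda>m. density (1 / (1 + real m)) x = F m x) sequentially"
        using eventually_ge_at_top[of "nat \<lceil>x\<rceil>"]
        by eventually_elim (use \<open>x > 0\<close> in \<open>auto simp: F_def d_def nat_ceiling_le_eq\<close>)
      with density_tendsto[OF \<open>x > 0\<close>] show ?thesis
        using False by (simp add: g_def tendsto_cong)
    qed (simp add: F_def g_def density_def)
  qed
  moreover have "integral {0..} g = K0"
    unfolding K0_def by (rule integral_spike[of "{0}"]) (auto simp: g_def)
  moreover have "integral {0..} (F m) \<le> K" for m
    using integral_density_le[OF n u d ulam, of m m] integral_unique[OF Fi[of m]] by simp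
  ultimately show ?thesis by (intro LIMSEQ_le_const2) auto
qed

end

subsection \<open>Vandermonde determinants\<close>

lemma finite_ordered_pairs: "finite {(i, j). i < j \<and> j < (m::nat)}"
  by (rule finite_subset[of _ "{..<m} \<times> {..<m}"]) auto

lemma vandermonde_Cons: "vandermonde (x # xs) = (\<Prod>y\<leftarrow>xs. y - x) * vandermonde xs"
proof -
  let ?S = "{(i, j). i < j \<and> j < length xs}"
  have S: "{(i, j). i < j \<and> j < length (x # xs)} = (\<lambda>j. (0, Suc j)) ` {..<length xs} \<union> map_prod Suc Suc ` ?S"
    (is "?L = ?R")
  proof
    show "?L \<subseteq> ?R"
    proof clarify
      fix i j assume "i < j" "j < length (x # xs)" "(i, j) \<notin> map_prod Suc Suc ` ?S"
      then show "(i, j) \<in> (\<lambda>j. (0, Suc j)) ` {..<length xs}"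
        by (cases i; cases j) force+
    qed
  qed auto
  have "vandermonde (x # xs) = (\<Prod>j<length xs. xs ! j - x) * (\<Prod>(i, j)\<in>?S. xs ! j - xs ! i)"
    unfolding vandermonde_def S using finite_ordered_pairs[of "length xs"]
    by (subst prod.union_disjoint)
      (auto simp: prod.reindex inj_on_def split_beta)
  then show ?thesis by (simp add: vandermonde_def prod.list_conv_set_nth atLeast0LessThan)
qed

text \<open>Isolates the factors involving one entry, oriented as later minus earlier. Deleting that
  entry is what leads from V to V_k.\<close>

lemma vandermonde_insert:
  "vandermonde (xs @ x # ys) = (\<Prod>y\<leftarrow>xs. x - y) * (\<Prod>y\<leftarrow>ys. y - x) * vandermonde (xs @ ys)"
  by (induction xs) (simp_all add: vandermonde_Cons mult_ac)

lemma vandermonde_nonzero: "distinct xs \<Longrightarrow> vandermonde xs \<noteq> 0"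
  by (induction xs) (auto simp: vandermonde_Cons vandermonde_def[of "[]"] prod_list_zero_iff)

section \<open>Ulam constants of \<open>lin_op\<close> and the Vandermonde form of
  \<open>K0\<close>\<close>

context hyperbolic_roots
begin

text \<open>Polynomials with equal values at all complex numbers have equal coefficients.\<close>

lemma lin_op_eq_poly_op:
  assumes "\<forall>z. z ^ n + (\<Sum>j=1..n. a j * z ^ (n - j)) = (\<Prod>k=1..n. z - r k)"
  shows "lin_op n a y t = poly_op n P y t"
proof -
  have "poly P = poly (monom 1 n + (\<Sum>j=1..n. monom (a j) (n - j)))"
    using assms by (auto simp: P_def poly_prod poly_sum poly_monom fun_eq_iff)
  then have "P = monom 1 n + (\<Sum>j=1..n. monom (a j) (n - j))"
    by (simp only: poly_eq_poly_eq_iff)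
  then have "poly_op n P y t = poly_op n (monom 1 n + (\<Sum>j=1..n. monom (a j) (n - j))) y t"
    by simp
  then show ?thesis
    by (simp add: poly_op_add poly_op_sum poly_op_monom lin_op_def)
qed

text \<open>The choice \<epsilon> = 1 gives the lower bound, Green's function the converse. The Ulam
  constants thus form a closed half line, and their infimum is attained.\<close>

lemma ulam_constant_iff:
  assumes n: "n \<ge> 1" and X: "\<exists>x::'a::{complex_normed_vector,banach}. x \<noteq> 0"
    and char: "\<forall>z. z ^ n + (\<Sum>j=1..n. a j * z ^ (n - j)) = (\<Prod>k=1..n. z - r k)"
  shows "ulam_constant n a TYPE('a) K \<longleftrightarrow> K0 \<le> K"
proof
  assume u: "ulam_constant n a TYPE('a) K"
  show "K0 \<le> K"
  proof (rule ulam_lower[OF n X])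
    fix y :: "real \<Rightarrow> 'a" assume y: "y \<in> Cn n" "\<And>t. norm (poly_op n P y t) \<le> 1"
    have "sup_gauge (lin_op n a y) \<le> ennreal 1"
      by (subst sup_gauge_le_iff) (simp_all add: lin_op_eq_poly_op[OF char] y)
    with u y(1) obtain z where z: "z \<in> Cn n" "lin_op n a z = (\<lambda>_. 0)"
        "sup_gauge (\<lambda>t. y t - z t) \<le> ennreal (K * 1)" and K: "0 \<le> K"
      unfolding ulam_constant_def using zero_less_one by meson
    have "poly_op n P z t = 0" for t using z(2) lin_op_eq_poly_op[OF char, of z] by metis
    with z K show "\<exists>z\<in>Cn n. (\<forall>t. poly_op n P z t = 0) \<and> (\<forall>t. norm (y t - z t) \<le> K)"
      by (auto simp: sup_gauge_le_iff)
  qed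
next
  assume K: "K0 \<le> K"
  show "ulam_constant n a TYPE('a) K"
    unfolding ulam_constant_def
  proof (intro conjI allI impI)
    show K_nonneg: "0 \<le> K" using K K0_nonneg by simp
    fix \<epsilon> :: real and y :: "real \<Rightarrow> 'a"
    assume \<epsilon>: "\<epsilon> > 0" and "y \<in> Cn n \<and> sup_gauge (lin_op n a y) \<le> ennreal \<epsilon>"
    then have y: "y \<in> Cn n" and b: "\<And>t. norm (poly_op n P y t) \<le> \<epsilon>"
      by (simp_all add: sup_gauge_le_iff lin_op_eq_poly_op[OF char])
    show "\<exists>z. z \<in> Cn n \<and> lin_op n a z = (\<lambda>_. 0) \<and>
        sup_gauge (\<lambda>t. y t - z t) \<le> ennreal (K * \<epsilon>)"
    proof (rule ulam_upper[OF n y b])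
      fix z :: "real \<Rightarrow> 'a"
      assume z: "z \<in> Cn n" "\<And>t. poly_op n P z t = 0" "\<And>t. norm (y t - z t) \<le> K0 * \<epsilon>"
      have "norm (y t - z t) \<le> K * \<epsilon>" for t
        using z(3)[of t] mult_right_mono[OF K, of \<epsilon>] \<epsilon> by linarith
      with z K_nonneg \<epsilon> show ?thesis
        by (intro exI[of _ z]) (simp add: sup_gauge_le_iff lin_op_eq_poly_op[OF char] fun_eq_iff)
    qed
  qed
qed

text \<open>The \<open>n - k\<close> factors with later roots have the opposite orientation to those
  in \<open>c k\<close>, giving the sign (-1)^(n-k); together with (-1)^n this is (-1)^k.\<close>

lemma vandermonde_c:
  assumes "k \<in> {1..n}"
  shows "(-1) ^ k * vandermonde (map r ([1..<k] @ [k+1..<n+1]))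
    = (-1) ^ n * vandermonde (map r [1..<n+1]) * c k"
proof -
  have split: "[1..<n+1] = [1..<k] @ k # [k+1..<n+1]"
    using assms upt_add_eq_append[of 1 k "n + 1 - k"] upt_conv_Cons[of k "n + 1"] by auto
  have "(\<Prod>y\<leftarrow>map r [1..<k]. r k - y) = (\<Prod>j\<in>{1..<k}. r k - r j)"
    by (simp add: comp_def prod.distinct_set_conv_list[symmetric] del: upt_Suc)
  moreover have "(\<Prod>y\<leftarrow>map r [k+1..<n+1]. y - r k) = (\<Prod>j\<in>{k+1..<n+1}. - 1 * (r k - r j))"
    by (simp add: comp_def prod.distinct_set_conv_list[symmetric] del: upt_Suc)
  moreover have "\<dots> = (-1) ^ (n - k) * (\<Prod>j\<in>{k+1..<n+1}. r k - r j)"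
    unfolding prod.distrib by simp
  moreover have "(\<Prod>j\<in>{1..n}-{k}. r k - r j)
      = (\<Prod>j\<in>{1..<k}. r k - r j) * (\<Prod>j\<in>{k+1..<n+1}. r k - r j)"
  proof -
    have "{1..n} - {k} = {1..<k} \<union> {k+1..<n+1}" using assms by auto
    then show ?thesis by (simp add: prod.union_disjoint)
  qed
  ultimately have V: "vandermonde (map r [1..<n+1])
      = (-1) ^ (n - k) * (\<Prod>j\<in>{1..n}-{k}. r k - r j) * vandermonde (map r ([1..<k] @ [k+1..<n+1]))"
    unfolding split by (simp add: vandermonde_insert mult_ac)
  have "(\<Prod>j\<in>{1..n}-{k}. r k - r j) * c k = 1"
    using assms by (auto simp: c_def dest: inj_onD[OF distinct])
  moreover have "(-1) ^ n * (-1) ^ (n - k) = ((-1) ^ k :: complex)"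
    using assms by (auto simp: power_add[symmetric] minus_one_power_iff)
  moreover have "(-1) ^ n * ((-1) ^ (n - k) * p * v) * c k = ((-1) ^ n * (-1) ^ (n - k)) * (p * c k) * v"
    for p v by (simp add: mult_ac)
  ultimately show ?thesis
    unfolding V by simp
qed

lemma vandermonde_roots_nonzero: "vandermonde (map r [1..<n+1]) \<noteq> 0"
proof (rule vandermonde_nonzero)
  have "{1..<n+1} = {1..n}" by auto
  then show "distinct (map r [1..<n+1])"
    using distinct by (simp add: distinct_map del: upt_Suc One_nat_def)
qed

text \<open>The remaining sign (-1)^n does not depend on \<open>k\<close>, so it leaves the sum and
  disappears under the modulus.\<close>

lemma norm_vandermonde_sum:
  assumes "S \<subseteq> {1..n}"
  shows "cmod (\<Sum>k\<in>S. (-1) ^ k * vandermonde (map r ([1..<k] @ [k+1..<n+1])) * e k)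
    = cmod (vandermonde (map r [1..<n+1])) * cmod (\<Sum>k\<in>S. c k * e k)"
proof -
  let ?V = "vandermonde (map r [1..<n+1])"
  have "(\<Sum>k\<in>S. (-1) ^ k * vandermonde (map r ([1..<k] @ [k+1..<n+1])) * e k)
      = (\<Sum>k\<in>S. (-1) ^ n * ?V * (c k * e k))"
    using assms vandermonde_c by (intro sum.cong refl) (auto simp: mult.assoc simp del: upt_Suc)
  also have "\<dots> = (-1) ^ n * ?V * (\<Sum>k\<in>S. c k * e k)" by (rule sum_distrib_left[symmetric])
  finally show ?thesis by (simp add: norm_mult norm_power)
qed

lemma K0_eq:
  defines "V \<equiv> vandermonde (map r [1..<n+1])"
    and "Vk \<equiv> (\<lambda>k. vandermonde (map r ([1..<k] @ [k+1..<n+1])))"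
  shows "K0 = 1 / cmod V * integral {0..} (\<lambda>x.
      cmod (\<Sum>k\<in>unstable. (-1) ^ k * Vk k * exp (- r k * of_real x))
      + cmod (\<Sum>k\<in>stable. (-1) ^ k * Vk k * exp (r k * of_real x)))"
proof -
  have S: "unstable \<subseteq> {1..n}" "stable \<subseteq> {1..n}" by (auto simp: stable_def unstable_def)
  have "(\<lambda>x. cmod (\<Sum>k\<in>unstable. (-1) ^ k * Vk k * exp (- r k * of_real x))
      + cmod (\<Sum>k\<in>stable. (-1) ^ k * Vk k * exp (r k * of_real x)))
      = (\<lambda>x. cmod V * (cmod (Gpos x) + cmod (Gneg x)))"
    unfolding Vk_def V_def S[THEN norm_vandermonde_sum] Gpos_def Gneg_def
    by (simp add: distrib_left add.commute)
  moreover have "V \<noteq> 0" unfolding V_def by (rule vandermonde_roots_nonzero)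
  ultimately show ?thesis by (simp add: K0_def)
qed

end

theorem theorem2:
  fixes n :: nat and a r :: "nat \<Rightarrow> complex"
  assumes X_nontriv: "\<exists>x::'a::{complex_normed_vector,banach}. x \<noteq> 0"
    and n_pos: "n \<ge> 1"
    and char_poly: "\<forall>z. z ^ n + (\<Sum>j=1..n. a j * z ^ (n - j)) = (\<Prod>k=1..n. z - r k)"
    and distinct: "inj_on r {1..n}"
    and nonzero_re: "\<forall>k\<in>{1..n}. Re (r k) \<noteq> 0"
  defines "V \<equiv> vandermonde (map r [1..<n+1])"
    and "Vk \<equiv> (\<lambda>k. vandermonde (map r ([1..<k] @ [k+1..<n+1])))"
  shows "ulam_constant n a TYPE('a) (K_D n a TYPE('a))
    \<and> ((\<forall>k\<in>{1..n}. Re (r k) > 0) \<longrightarrow>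
        K_D n a TYPE('a) = 1 / cmod V *
          integral {0..} (\<lambda>x. cmod (\<Sum>k=1..n. (-1) ^ k * Vk k * exp (- r k * complex_of_real x))))
    \<and> ((\<forall>k\<in>{1..n}. Re (r k) < 0) \<longrightarrow>
        K_D n a TYPE('a) = 1 / cmod V *
          integral {0..} (\<lambda>x. cmod (\<Sum>k=1..n. (-1) ^ k * Vk k * exp (r k * complex_of_real x))))
    \<and> (\<forall>p. 1 \<le> p \<and> p < n \<and> (\<forall>k\<in>{1..p}. Re (r k) > 0) \<and> (\<forall>k\<in>{p+1..n}. Re (r k) < 0) \<longrightarrow>
        K_D n a TYPE('a) = 1 / cmod V *
          integral {0..} (\<lambda>x. cmod (\<Sum>k=1..p. (-1) ^ k * Vk k * exp (- r k * complex_of_real x))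
                             + cmod (\<Sum>k=p+1..n. (-1) ^ k * Vk k * exp (r k * complex_of_real x))))"
proof -
  interpret hyperbolic_roots n r
    using distinct nonzero_re by unfold_locales auto
  note iff = ulam_constant_iff[OF n_pos X_nontriv char_poly]
  have K_D: "K_D n a TYPE('a) = K0"
    unfolding K_D_def iff by (intro cInf_eq_minimum) auto
  have eq: "K0 = 1 / cmod V * integral {0..} (\<lambda>x.
      cmod (\<Sum>k\<in>unstable. (-1) ^ k * Vk k * exp (- r k * complex_of_real x))
      + cmod (\<Sum>k\<in>stable. (-1) ^ k * Vk k * exp (r k * complex_of_real x)))"
    unfolding V_def Vk_def by (rule K0_eq)
  show ?thesis
  proof (intro conjI impI allI)
    show "ulam_constant n a TYPE('a) (K_D n a TYPE('a))" unfolding iff K_D by simp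
  next
    assume pos: "\<forall>k\<in>{1..n}. Re (r k) > 0"
    then have "unstable = {1..n}" "stable = {}"
      by (force simp: stable_def unstable_def)+
    with eq show "K_D n a TYPE('a) = 1 / cmod V *
        integral {0..} (\<lambda>x. cmod (\<Sum>k=1..n. (-1) ^ k * Vk k * exp (- r k * complex_of_real x)))"
      unfolding K_D by simp
  next
    assume neg: "\<forall>k\<in>{1..n}. Re (r k) < 0"
    then have "unstable = {}" "stable = {1..n}"
      by (force simp: stable_def unstable_def)+
    with eq show "K_D n a TYPE('a) = 1 / cmod V *
        integral {0..} (\<lambda>x. cmod (\<Sum>k=1..n. (-1) ^ k * Vk k * exp (r k * complex_of_real x)))"
      unfolding K_D by simp
  next
    fix p
    assume p: "1 \<le> p \<and> p < n \<and> (\<forall>k\<in>{1..p}. Re (r k) > 0) \<and> (\<forall>k\<in>{p+1..n}. Re (r k) < 0)"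
    have sign: "(0 < Re (r k) \<longleftrightarrow> k \<le> p) \<and> (Re (r k) < 0 \<longleftrightarrow> p < k)" if "k \<in> {1..n}" for k
    proof (cases "k \<le> p")
      case True
      then have "0 < Re (r k)" using p that by simp
      with True show ?thesis by simp
    next
      case False
      then have "Re (r k) < 0" using p that by simp
      with False show ?thesis by simp
    qed
    have "unstable = {1..p}" "stable = {p+1..n}"
      using p sign by (force simp: unstable_def stable_def)+
    with eq show "K_D n a TYPE('a) = 1 / cmod V *
        integral {0..} (\<lambda>x. cmod (\<Sum>k=1..p. (-1) ^ k * Vk k * exp (- r k * complex_of_real x))
          + cmod (\<Sum>k=p+1..n. (-1) ^ k * Vk k * exp (r k * complex_of_real x)))"
      unfolding K_D by simp
  qed
qed

end
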